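(* Let $C\subset\mathsf{Ein}^3$ be the crooked surface given by $u_+,u_-,v_+,v_-\in V$. The photon represented by a nonzero vector $p\in V$ is disjoint from $C$ if and only if the following two inequalities are satisfied: $$\omega(p,v_+)\,\omega(p,u_+)>0,\qquad \omega(p,v_-)\,\omega(p,u_-)<0.$$
   Context: Let $(V,\omega)$ be a $4$-dimensional real symplectic vector space. The Einstein universe $\mathsf{Ein}^3$ is modelled by the set of Lagrangian $2$-planes of $V$. A nonzero vector $p\in V$ represents a photon $[p]$, namely the set of all Lagrangian $2$-planes containing the line $\mathbb R p$. For pairwise transverse Lagrangian planes $L,P,L'$, let $\pi_L,\pi_{L'}$ be the projections for the splitting $V=L\oplus L'$, and let $q_{L,L'}(v)=\omega(\pi_L(v),\pi_{L'}(v))$. The Maslov index is $m(L,P,L')=\mathrm{sign}(q_{L,L'}|_P)$, the number of positive minus the number of negative eigenvalues. Crooked surface: let $u_+,u_-,v_+,v_-\in V$ be four vectors with $\omega(u_+,v_-)=\omega(u_-,v_+)=1$ and all other $\omega$-products between these four vectors equal to zero. Put $P_0=\mathbb R v_++\mathbb R v_-$, $P_\infty=\mathbb R u_++\mathbb R u_-$. The wings are the unions of the photons in the families $\mathcal W_+=\{[tu_++sv_+] : ts\ge 0\}$ and $\mathcal W_-=\{[tu_-+sv_-] : ts\le 0\}$ (with $(t,s)\neq(0,0)$). With $S_1=\mathbb R u_++\mathbb R v_-$ and $S_2=\mathbb R u_-+\mathbb R v_+$, the stem is $$\mathcal S=\{L=\mathbb R w+\mathbb R w' : w\in S_1,\ w'\in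 S_2 \text{ nonzero},\ L \text{ transverse to } P_0 \text{ and } P_\infty,\ |m(P_0,L,P_\infty)|=2\}.$$ The crooked surface $C$ given by $u_+,u_-,v_+,v_-$ is the union in $\mathsf{Ein}^3$ of the two wings and the stem. *)

theory Defs
  imports
    "HOL-Analysis.Analysis"
    "Jordan_Normal_Form.Char_Poly"
begin

definition symplectic_form :: "('v::real_vector \<Rightarrow> 'v \<Rightarrow> real) \<Rightarrow> bool" where
  "symplectic_form \<omega> \<longleftrightarrow>
     bilinear \<omega> \<and> (\<forall>x. \<omega> x x = 0) \<and> (\<forall>x. (\<forall>y. \<omega> x y = 0) \<longrightarrow> x = 0)"

text \<open>In dimension four the Lagrangian subspaces are exactly the isotropic planes.\<close>

definition lagrangian :: "('v::real_vector \<Rightarrow> 'v \<Rightarrow> real) \<Rightarrow> 'v set \<Rightarrow> bool" where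
  "lagrangian \<omega> L \<longleftrightarrow> subspace L \<and> dim L = 2 \<and> (\<forall>x\<in>L. \<forall>y\<in>L. \<omega> x y = 0)"

definition Ein :: "('v::real_vector \<Rightarrow> 'v \<Rightarrow> real) \<Rightarrow> 'v set set" where
  "Ein \<omega> = {L. lagrangian \<omega> L}"

definition photon :: "('v::real_vector \<Rightarrow> 'v \<Rightarrow> real) \<Rightarrow> 'v \<Rightarrow> 'v set set" where
  "photon \<omega> p = {L \<in> Ein \<omega>. span {p} \<subseteq> L}"

text \<open>Two planes of a four-dimensional space that meet only in \<open>0\<close> are complementary.\<close>

definition transverse :: "'v::real_vector set \<Rightarrow> 'v set \<Rightarrow> bool" where
  "transverse L L' \<longleftrightarrow> L \<inter> L' = {0}"

text \<open>The projection onto \<open>L\<close> with kernel \<open>L'\<close>; meaningful when \<open>L\<close> and \<open>L'\<close> are complementary.\<close>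

definition proj_along :: "'v::real_vector set \<Rightarrow> 'v set \<Rightarrow> 'v \<Rightarrow> 'v" where
  "proj_along L L' v = (THE x. x \<in> L \<and> v - x \<in> L')"

definition maslov_form ::
    "('v::real_vector \<Rightarrow> 'v \<Rightarrow> real) \<Rightarrow> 'v set \<Rightarrow> 'v set \<Rightarrow> 'v \<Rightarrow> real" where
  "maslov_form \<omega> L L' v = \<omega> (proj_along L L' v) (proj_along L' L v)"

definition polar_form :: "('v::real_vector \<Rightarrow> real) \<Rightarrow> 'v \<Rightarrow> 'v \<Rightarrow> real" where
  "polar_form q x y = (q (x + y) - q x - q y) / 2"

definition gram_matrix :: "('v \<Rightarrow> 'v \<Rightarrow> real) \<Rightarrow> 'v list \<Rightarrow> real mat" where
  "gram_matrix B bs = mat (length bs) (length bs) (\<lambda>(i, j). B (bs ! i) (bs ! j))"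

definition basis_list :: "'v::real_vector set \<Rightarrow> 'v list \<Rightarrow> bool" where
  "basis_list W bs \<longleftrightarrow> distinct bs \<and> independent (set bs) \<and> span (set bs) = W"

text \<open>The sums below count eigenvalues with algebraic multiplicity.\<close>

definition mat_signature :: "real mat \<Rightarrow> int" where
  "mat_signature A =
     (\<Sum>x | eigenvalue A x \<and> x > 0. int (order x (char_poly A))) -
     (\<Sum>x | eigenvalue A x \<and> x < 0. int (order x (char_poly A)))"

text \<open>
  The signature of the quadratic form \<open>q\<close> restricted to the finite-dimensional subspace \<open>W\<close>.
  By Sylvester's law of inertia it does not depend on the chosen basis.
\<close>

definition signature_on :: "('v::real_vector \<Rightarrow> real) \<Rightarrow> 'v set \<Rightarrow> int" where
  "signature_on q W = mat_signature (gram_matrix (polar_form q) (SOME bs. basis_list W bs))"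

text \<open>Meaningful for pairwise transverse Lagrangian planes; it is applied only to such triples.\<close>

definition maslov_index ::
    "('v::real_vector \<Rightarrow> 'v \<Rightarrow> real) \<Rightarrow> 'v set \<Rightarrow> 'v set \<Rightarrow> 'v set \<Rightarrow> int" where
  "maslov_index \<omega> L P L' = signature_on (maslov_form \<omega> L L') P"

text \<open>
  \<open>up\<close>, \<open>um\<close>, \<open>vp\<close>, \<open>vm\<close> stand for \<open>u\<close> and \<open>v\<close> with subscript plus or minus. For an alternating form
  the six products listed determine all the others.
\<close>

definition crooked_frame ::
    "('v::real_vector \<Rightarrow> 'v \<Rightarrow> real) \<Rightarrow> 'v \<Rightarrow> 'v \<Rightarrow> 'v \<Rightarrow> 'v \<Rightarrow> bool" where
  "crooked_frame \<omega> up um vp vm \<longleftrightarrow>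
     \<omega> up vm = 1 \<and> \<omega> um vp = 1 \<and>
     \<omega> up um = 0 \<and> \<omega> up vp = 0 \<and> \<omega> um vm = 0 \<and> \<omega> vp vm = 0"

definition wing_plus ::
    "('v::real_vector \<Rightarrow> 'v \<Rightarrow> real) \<Rightarrow> 'v \<Rightarrow> 'v \<Rightarrow> 'v set set" where
  "wing_plus \<omega> up vp =
     \<Union>{photon \<omega> (t *\<^sub>R up + s *\<^sub>R vp) | t s. t * s \<ge> 0 \<and> (t, s) \<noteq> (0, 0)}"

definition wing_minus ::
    "('v::real_vector \<Rightarrow> 'v \<Rightarrow> real) \<Rightarrow> 'v \<Rightarrow> 'v \<Rightarrow> 'v set set" where
  "wing_minus \<omega> um vm =
     \<Union>{photon \<omega> (t *\<^sub>R um + s *\<^sub>R vm) | t s. t * s \<le> 0 \<and> (t, s) \<noteq> (0, 0)}"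

text \<open>
  For a crooked frame the planes \<open>span {up, vm}\<close> and \<open>span {um, vp}\<close> are orthogonal for the form and
  meet only in \<open>0\<close>, so every plane in the stem is Lagrangian.
\<close>

definition stem ::
    "('v::real_vector \<Rightarrow> 'v \<Rightarrow> real) \<Rightarrow> 'v \<Rightarrow> 'v \<Rightarrow> 'v \<Rightarrow> 'v \<Rightarrow> 'v set set" where
  "stem \<omega> up um vp vm =
     {L. \<exists>w w'. w \<in> span {up, vm} \<and> w' \<in> span {um, vp} \<and> w \<noteq> 0 \<and> w' \<noteq> 0 \<and>
        L = span {w, w'} \<and>
        transverse L (span {vp, vm}) \<and> transverse L (span {up, um}) \<and>
        \<bar>maslov_index \<omega> (span {vp, vm}) L (span {up, um})\<bar> = 2}"

definition crooked_surface ::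
    "('v::real_vector \<Rightarrow> 'v \<Rightarrow> real) \<Rightarrow> 'v \<Rightarrow> 'v \<Rightarrow> 'v \<Rightarrow> 'v \<Rightarrow> 'v set set" where
  "crooked_surface \<omega> up um vp vm =
     wing_plus \<omega> up vp \<union> wing_minus \<omega> um vm \<union> stem \<omega> up um vp vm"

end

theory Submission
  imports Defs
begin

text \<open>
  In the basis of the frame write \<open>p = a up + b um + c vp + d vm\<close>. Two photons \<open>[p]\<close>, \<open>[q]\<close> meet
  exactly when \<open>\<omega> p q = 0\<close>, so \<open>[p]\<close> misses the positive wing iff \<open>b d < 0\<close> and the negative wing
  iff \<open>a c > 0\<close>; these are the two inequalities. Under them the stem is missed automatically: if
  \<open>p\<close> lies in \<open>span {w, w'}\<close> with \<open>w = x up + y vm\<close> and \<open>w' = z um + r vp\<close>, then the Maslov form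
  is diagonal in \<open>w, w'\<close> with entries \<open>- x y\<close> and \<open>- z r\<close>, whose product has the sign of
  \<open>(a d) (b c) < 0\<close>, so its signature is \<open>0\<close>.
\<close>

section \<open>Planes and bases in a real vector space\<close>

lemma independent_pairI:
  fixes x y :: "'v::real_vector"
  assumes "\<And>s t. s *\<^sub>R x + t *\<^sub>R y = 0 \<Longrightarrow> s = 0 \<and> t = 0"
  shows "x \<noteq> y" "independent {x, y}"
proof -
  show ne: "x \<noteq> y"
    using assms[of 1 "-1"] by auto
  have "y \<noteq> 0"
    using assms[of 0 1] by auto
  moreover have "x \<notin> span {y}"
  proof
    assume "x \<in> span {y}"
    then obtain k where "x = k *\<^sub>R y"
      by (auto simp: span_singleton)
    then show False
      using assms[of 1 "-k"] by auto
  qed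
  ultimately show "independent {x, y}"
    using ne by (simp add: independent_insert)
qed

lemma span_pair:
  fixes x y :: "'v::real_vector"
  shows "span {x, y} = {s *\<^sub>R x + t *\<^sub>R y | s t. True}"
proof -
  have "v - s *\<^sub>R x = t *\<^sub>R y \<longleftrightarrow> v = s *\<^sub>R x + t *\<^sub>R y" for v s t
    by (auto simp: algebra_simps)
  then show ?thesis
    by (auto simp: span_insert span_singleton image_iff)
qed

text \<open>A vector outside the span would extend \<open>B\<close> to an independent set larger
  than a basis \<open>T\<close> of the whole space. Since \<open>card\<close> of an infinite set is
  0, the condition \<open>0 < card B\<close> is what makes both \<open>B\<close> and
  \<open>T\<close> finite.\<close>

lemma independent_card_eq_dim_span:
  fixes B :: "'v::real_vector set"
  assumes "independent B" "card B = dim (UNIV :: 'v set)" "0 < card B"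
  shows "span B = UNIV"
proof (rule ccontr)
  assume "span B \<noteq> UNIV"
  then obtain v where v: "v \<notin> span B"
    by auto
  obtain T :: "'v set" where T: "independent T" "span T = UNIV" "card T = dim (UNIV :: 'v set)"
    using basis_exists[of "UNIV :: 'v set"] by (metis top.extremum_uniqueI)
  have fin: "finite B" "finite T"
    using assms T by (auto intro: card_ge_0_finite)
  have "v \<notin> B"
    using v span_base by blast
  moreover have "independent (insert v B)"
    using v assms(1) by (simp add: independent_insertI)
  then have "card (insert v B) \<le> card T"
    using independent_span_bound[of T "insert v B"] fin(2) T(2) by auto
  ultimately show False
    using assms(2) T(3) fin(1) by simp
qed

section \<open>Signature of indefinite binary quadratic forms\<close>

lemma det_dim_2:
  fixes A :: "'a::comm_ring_1 mat"
  assumes A: "A \<in> carrier_mat 2 2"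
  shows "Determinant.det A = A $$ (0,0) * A $$ (1,1) - A $$ (0,1) * A $$ (1,0)"
proof -
  have "mat_delete A i 0 \<in> carrier_mat 1 1" for i
    using A by (simp add: mat_delete_def)
  then show ?thesis
    using A
    by (subst laplace_expansion_column[of _ 2 0])
      (auto simp: cofactor_def det_single mat_delete_def numeral_2_eq_2)
qed

lemma char_poly_dim_2:
  fixes A :: "real mat"
  assumes A: "A \<in> carrier_mat 2 2"
  shows "char_poly A = [: A $$ (0,0) * A $$ (1,1) - A $$ (0,1) * A $$ (1,0),
                          - (A $$ (0,0) + A $$ (1,1)), 1 :]"
  using A det_dim_2[of "char_poly_matrix A"]
  by (simp add: char_poly_def char_poly_matrix_def)

text \<open>A negative determinant makes the discriminant of the characteristic polynomial positive
  and the product of its two roots negative. So there is one simple eigenvalue of each sign, and the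
  two counts cancel.\<close>

lemma mat_signature_indefinite:
  fixes A :: "real mat"
  assumes A: "A \<in> carrier_mat 2 2"
    and neg: "A $$ (0,0) * A $$ (1,1) - A $$ (0,1) * A $$ (1,0) < 0"
  shows "mat_signature A = 0"
proof -
  define d where "d = A $$ (0,0) * A $$ (1,1) - A $$ (0,1) * A $$ (1,0)"
  define t where "t = A $$ (0,0) + A $$ (1,1)"
  define s where "s = sqrt (t\<^sup>2 - 4 * d)"
  define x where "x = (t - s) / 2"
  define y where "y = (t + s) / 2"
  have "d < 0"
    using neg d_def by simp
  then have gt: "t\<^sup>2 < t\<^sup>2 - 4 * d"
    by simp
  then have s2: "s\<^sup>2 = t\<^sup>2 - 4 * d"
    unfolding s_def by (smt (verit) real_sqrt_pow2 zero_le_power2)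
  \<comment> \<open>\<open>x\<close> and \<open>y\<close> are the roots given by the quadratic
    formula; this bound puts them on opposite sides of 0.\<close>
  have "\<bar>t\<bar> < s"
    unfolding s_def using gt by (metis real_sqrt_abs real_sqrt_less_iff)
  then have xy: "x < 0" "0 < y"
    by (auto simp: x_def y_def)
  have "x * y = d"
    using s2 by (simp add: x_def y_def field_simps power2_eq_square)
  moreover have "x + y = t"
    by (simp add: x_def y_def field_simps)
  ultimately have cp: "char_poly A = [:- x, 1:] * [:- y, 1:]"
    unfolding char_poly_dim_2[OF A] d_def t_def by (simp add: mult.commute)
  have ev: "eigenvalue A k \<longleftrightarrow> k = x \<or> k = y" for k
    by (subst eigenvalue_root_char_poly[OF A]) (simp add: cp del: mult_pCons_left mult_pCons_right)
  \<comment> \<open>Orders add over the product, and the factor with root \<open>y\<close> has order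
    0 at \<open>x\<close> because \<open>x < 0 < y\<close>.\<close>
  have ordx: "order x (char_poly A) = 1"
    unfolding cp using xy order_power_n_n[of x 1]
    by (subst order_mult) (auto simp: order_0I)
  have ordy: "order y (char_poly A) = 1"
    unfolding cp using xy order_power_n_n[of y 1]
    by (subst order_mult) (auto simp: order_0I)
  have "{k. eigenvalue A k \<and> k > 0} = {y}" "{k. eigenvalue A k \<and> k < 0} = {x}"
    using xy by (auto simp: ev)
  then show ?thesis
    unfolding mat_signature_def using ordx ordy by simp
qed

text \<open>The basis behind \<open>signature_on\<close> is an arbitrary choice, so the Gram matrix
  has to be treated in every basis. Its determinant is \<open>A * B\<close> times the square of the
  change-of-basis determinant, hence negative in all of them; this replaces an appeal to Sylvester's
  law.\<close>

lemma signature_on_indefinite_plane: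
  fixes q :: "'v::real_vector \<Rightarrow> real"
  assumes ind: "w \<noteq> w'" "independent {w, w'}"
    and q: "\<And>s t. q (s *\<^sub>R w + t *\<^sub>R w') = A * s\<^sup>2 + B * t\<^sup>2"
    and AB: "A * B < 0"
  shows "signature_on q (span {w, w'}) = 0"
proof -
  define bs where "bs = (SOME bs. basis_list (span {w, w'}) bs)"
  have "basis_list (span {w, w'}) [w, w']"
    using ind by (simp add: basis_list_def)
  then have bs: "basis_list (span {w, w'}) bs"
    unfolding bs_def by (rule someI)
  then have "card (set bs) = dim (span {w, w'})"
    by (metis basis_list_def dim_span_eq_card_independent)
  also have "\<dots> = 2"
    using ind by (simp add: dim_eq_card_independent)
  finally have "length bs = 2"
    using bs by (simp add: basis_list_def distinct_card)
  then obtain e f where ef: "bs = [e, f]"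
    by (auto simp: length_Suc_conv numeral_2_eq_2)
  then have "e \<in> span {w, w'}" "f \<in> span {w, w'}"
    using bs span_base[of _ "set bs"] by (auto simp: basis_list_def)
  then obtain s t s' t' where e: "e = s *\<^sub>R w + t *\<^sub>R w'" and f: "f = s' *\<^sub>R w + t' *\<^sub>R w'"
    by (auto simp: span_pair)
  have polar: "polar_form q (i *\<^sub>R w + j *\<^sub>R w') (k *\<^sub>R w + l *\<^sub>R w') = A * i * k + B * j * l"
    for i j k l
  proof -
    have "(i *\<^sub>R w + j *\<^sub>R w') + (k *\<^sub>R w + l *\<^sub>R w') = (i + k) *\<^sub>R w + (j + l) *\<^sub>R w'"
      by (simp add: algebra_simps)
    then show ?thesis
      unfolding polar_form_def by (simp only: q) (simp add: field_simps power2_eq_square)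
  qed
  \<comment> \<open>If the change-of-basis determinant vanished, Cramer's rule would give two linear
    relations between \<open>e\<close> and \<open>f\<close>; independence then kills
    \<open>t'\<close> and \<open>s'\<close>, and so \<open>f\<close>.\<close>
  have "s * t' - t * s' \<noteq> 0"
  proof
    assume 0: "s * t' - t * s' = 0"
    have "t' *\<^sub>R e - t *\<^sub>R f = (s * t' - t * s') *\<^sub>R w"
      "s' *\<^sub>R e - s *\<^sub>R f = - (s * t' - t * s') *\<^sub>R w'"
      by (simp_all add: e f algebra_simps)
    then have z: "t' *\<^sub>R e - t *\<^sub>R f = 0" "s' *\<^sub>R e - s *\<^sub>R f = 0"
      by (simp_all add: 0)
    have "independent {e, f}" "e \<noteq> f"
      using bs by (auto simp: basis_list_def ef)
    then have nf: "e \<notin> span {f}" "f \<noteq> 0"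
      by (auto simp: independent_insert)
    have "k = 0" if "k *\<^sub>R e = l *\<^sub>R f" for k l
    proof (rule ccontr)
      assume "k \<noteq> 0"
      then have "e = (l / k) *\<^sub>R f"
        using that by (metis divide_inverse_commute scaleR_scaleR left_inverse scaleR_one)
      then show False
        using nf by (auto simp: span_singleton)
    qed
    then have "t' = 0" "s' = 0"
      using z by auto
    then show False
      using nf by (simp add: f)
  qed
  then have "0 < (s * t' - t * s')\<^sup>2"
    by simp
  then have "A * B * (s * t' - t * s')\<^sup>2 < 0"
    using AB by (simp add: mult_neg_pos)
  also have "A * B * (s * t' - t * s')\<^sup>2 =
      (A * s * s + B * t * t) * (A * s' * s' + B * t' * t') -
      (A * s * s' + B * t * t') * (A * s' * s + B * t' * t)"
    by (simp add: power2_eq_square algebra_simps)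
  finally have "mat_signature (gram_matrix (polar_form q) bs) = 0"
    by (intro mat_signature_indefinite) (auto simp: gram_matrix_def ef e f polar)
  then show ?thesis
    by (simp add: signature_on_def bs_def)
qed

section \<open>Projections, and zeros of a linear form in two opposite quadrants\<close>

lemma proj_along_eqI:
  assumes "subspace L" "subspace L'" "L \<inter> L' = {0}" "x \<in> L" "v - x \<in> L'"
  shows "proj_along L L' v = x"
  unfolding proj_along_def
proof (rule the_equality)
  show "x \<in> L \<and> v - x \<in> L'"
    using assms by simp
  fix y
  assume y: "y \<in> L \<and> v - y \<in> L'"
  have "y - x \<in> L"
    using assms y by (simp add: subspace_diff)
  moreover have "(v - x) - (v - y) \<in> L'"
    using assms y by (blast intro: subspace_diff)
  then have "y - x \<in> L'"
    by simp
  ultimately have "y - x \<in> L \<inter> L'"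
    by blast
  then show "y = x"
    by (simp add: assms(3))
qed

text \<open>Unless \<open>x = y = 0\<close>, the zeros \<open>(t, s)\<close> form the line through
  \<open>(y, - x)\<close>, on which \<open>t * s\<close> has the sign of \<open>- (x * y)\<close>
  away from the origin.\<close>

lemma positive_quadrant_no_root_iff:
  fixes x y :: real
  shows "(\<forall>t s. t * s \<ge> 0 \<and> (t, s) \<noteq> (0, 0) \<longrightarrow> t * x + s * y \<noteq> 0) \<longleftrightarrow> y * x > 0"
proof
  assume *: "\<forall>t s. t * s \<ge> 0 \<and> (t, s) \<noteq> (0, 0) \<longrightarrow> t * x + s * y \<noteq> 0"
  show "y * x > 0"
  proof (rule ccontr)
    assume "\<not> y * x > 0"
    then have "y * (- x) \<ge> 0"
      by simp
    with *[rule_format, of y "- x"] have "y = 0" "x = 0"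
      by auto
    with *[rule_format, of 1 0] show False
      by simp
  qed
next
  assume xy: "y * x > 0"
  show "\<forall>t s. t * s \<ge> 0 \<and> (t, s) \<noteq> (0, 0) \<longrightarrow> t * x + s * y \<noteq> 0"
  proof (intro allI impI notI)
    fix t s :: real
    assume ts: "t * s \<ge> 0 \<and> (t, s) \<noteq> (0, 0)" and eq: "t * x + s * y = 0"
    \<comment> \<open>Multiplying the equation by \<open>t * x\<close> turns it into a vanishing sum
      of two nonnegative terms.\<close>
    have "t\<^sup>2 * x\<^sup>2 + (t * s) * (y * x) = t * x * (t * x + s * y)"
      by (simp add: power2_eq_square algebra_simps)
    with eq have "t\<^sup>2 * x\<^sup>2 + (t * s) * (y * x) = 0"
      by simp
    moreover have "(t * s) * (y * x) \<ge> 0"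
      using xy ts by simp
    moreover have "t\<^sup>2 * x\<^sup>2 \<ge> 0"
      by simp
    ultimately have "t\<^sup>2 * x\<^sup>2 = 0"
      by linarith
    with xy have "t = 0"
      by auto
    with eq ts xy show False
      by auto
  qed
qed

section \<open>Coordinates in the crooked frame\<close>

locale crooked_space =
  fixes \<omega> :: "'v::real_vector \<Rightarrow> 'v \<Rightarrow> real"
    and up um vp vm :: 'v
  assumes dim4: "dim (UNIV :: 'v set) = 4"
    and form: "symplectic_form \<omega>"
    and frame: "crooked_frame \<omega> up um vp vm"
begin

lemma bil: "bilinear \<omega>"
  using form by (simp add: symplectic_form_def)

lemmas bil_simps =
  bilinear_ladd[OF bil] bilinear_radd[OF bil] bilinear_lmul[OF bil] bilinear_rmul[OF bil]
  bilinear_lzero[OF bil] bilinear_rzero[OF bil]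

lemma self [simp]: "\<omega> x x = 0"
  using form by (simp add: symplectic_form_def)

lemma skew: "\<omega> y x = - \<omega> x y"
proof -
  have "\<omega> (x + y) (x + y) = 0"
    by (rule self)
  then have "\<omega> x y + \<omega> y x = 0"
    unfolding bil_simps by simp
  then show ?thesis
    by simp
qed

lemma frame_values [simp]:
  "\<omega> up vm = 1" "\<omega> um vp = 1" "\<omega> up um = 0" "\<omega> up vp = 0" "\<omega> um vm = 0" "\<omega> vp vm = 0"
  using frame by (simp_all add: crooked_frame_def)

lemma frame_values_skew [simp]:
  "\<omega> vm up = -1" "\<omega> vp um = -1" "\<omega> um up = 0" "\<omega> vp up = 0" "\<omega> vm um = 0" "\<omega> vm vp = 0"
  by (subst skew, simp)+

definition comb :: "real \<Rightarrow> real \<Rightarrow> real \<Rightarrow> real \<Rightarrow> 'v" where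
  "comb a b c d = a *\<^sub>R up + b *\<^sub>R um + c *\<^sub>R vp + d *\<^sub>R vm"

lemma omega_comb:
  "\<omega> (comb a b c d) up = - d" "\<omega> (comb a b c d) um = - c"
  "\<omega> (comb a b c d) vp = b" "\<omega> (comb a b c d) vm = a"
  "\<omega> (comb a b c d) (comb a' b' c' d') = a * d' + b * c' - c * b' - d * a'"
  by (simp_all add: comb_def bil_simps algebra_simps)

text \<open>Pairing with the four frame vectors recovers the coordinates up to sign. As a simp rule
  this reduces vector equations to real ones.\<close>

lemma comb_inject [simp]:
  "comb a b c d = comb a' b' c' d' \<longleftrightarrow> a = a' \<and> b = b' \<and> c = c' \<and> d = d'"
  by (metis omega_comb(1-4) neg_equal_iff_equal)

lemma comb_0: "comb 0 0 0 0 = 0"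
  by (simp add: comb_def)

lemma comb_eq_0 [simp]: "comb a b c d = 0 \<longleftrightarrow> a = 0 \<and> b = 0 \<and> c = 0 \<and> d = 0"
  using comb_inject[of a b c d 0 0 0 0] by (simp add: comb_0)

lemma comb_arith:
  "comb a b c d + comb a' b' c' d' = comb (a + a') (b + b') (c + c') (d + d')"
  "comb a b c d - comb a' b' c' d' = comb (a - a') (b - b') (c - c') (d - d')"
  "k *\<^sub>R comb a b c d = comb (k * a) (k * b) (k * c) (k * d)"
  by (simp_all add: comb_def algebra_simps)

lemma scaleR_frame:
  "t *\<^sub>R up = comb t 0 0 0" "t *\<^sub>R um = comb 0 t 0 0" "t *\<^sub>R vp = comb 0 0 t 0" "t *\<^sub>R vm = comb 0 0 0 t"
  by (simp_all add: comb_def)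

lemma span_frame: "span {up, um, vp, vm} = UNIV"
proof (rule independent_card_eq_dim_span)
  have dist: "up \<noteq> um" "up \<noteq> vp" "up \<noteq> vm" "um \<noteq> vp" "um \<noteq> vm" "vp \<noteq> vm"
    using frame_values frame_values_skew self by (metis zero_neq_one)+
  then show "card {up, um, vp, vm} = dim (UNIV :: 'v set)" "0 < card {up, um, vp, vm}"
    using dim4 by simp_all
  show "independent {up, um, vp, vm}"
  proof
    assume "dependent {up, um, vp, vm}"
    then obtain k where k: "\<exists>v\<in>{up, um, vp, vm}. k v \<noteq> 0"
      and "(\<Sum>v\<in>{up, um, vp, vm}. k v *\<^sub>R v) = 0"
      by (subst (asm) dependent_finite) auto
    then have "comb (k up) (k um) (k vp) (k vm) = 0"
      using dist by (simp add: comb_def add.assoc)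
    with k show False
      by auto
  qed
qed

lemma comb_cases:
  obtains a b c d where "v = comb a b c d"
proof -
  have "v \<in> span {up, um, vp, vm}"
    by (simp add: span_frame)
  then obtain a b c d where "v - a *\<^sub>R up - b *\<^sub>R um - c *\<^sub>R vp = d *\<^sub>R vm"
    by (auto simp: span_insert span_singleton)
  then have "v = comb a b c d"
    by (simp add: comb_def algebra_simps)
  then show ?thesis
    by (rule that)
qed

section \<open>Incidence of photons\<close>

lemma span_pair_in_Ein:
  assumes "\<And>s t. s *\<^sub>R x + t *\<^sub>R y = 0 \<Longrightarrow> s = 0 \<and> t = 0" "\<omega> x y = 0"
  shows "span {x, y} \<in> Ein \<omega>"
proof -
  have "dim (span {x, y}) = 2"
    using independent_pairI[of x y] assms(1) by (simp add: dim_eq_card_independent)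
  moreover have "\<omega> y x = 0"
    using assms(2) skew[of x y] by simp
  then have "\<omega> v w = 0" if "v \<in> span {x, y}" "w \<in> span {x, y}" for v w
    using that assms(2) by (auto simp: span_pair bil_simps)
  ultimately show ?thesis
    by (simp add: Ein_def lagrangian_def)
qed

text \<open>Split \<open>p\<close> along the orthogonal planes \<open>span {up, vm}\<close> and
  \<open>span {um, vp}\<close>. If both parts are nonzero, the first part serves as
  \<open>q\<close>; otherwise \<open>p\<close> lies in one plane and a frame vector of the other one
  serves.\<close>

lemma ex_independent_orthogonal:
  assumes "p \<noteq> 0"
  obtains q where "\<omega> p q = 0" "\<And>s t. s *\<^sub>R p + t *\<^sub>R q = 0 \<Longrightarrow> s = 0 \<and> t = 0"
proof -
  obtain a b c d where p: "p = comb a b c d"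
    by (rule comb_cases)
  consider "b = 0" "c = 0" | "a = 0" "d = 0" | "b \<noteq> 0 \<or> c \<noteq> 0" "a \<noteq> 0 \<or> d \<noteq> 0"
    by blast
  then show ?thesis
  proof cases
    case 1
    then show ?thesis
      using assms that[of um] by (auto simp: p omega_comb scaleR_frame(2) comb_arith)
  next
    case 2
    then show ?thesis
      using assms that[of up] by (auto simp: p omega_comb scaleR_frame(1) comb_arith)
  next
    case 3
    then show ?thesis
      using that[of "comb a 0 0 d"] by (auto simp: p omega_comb comb_arith)
  qed
qed

lemma photons_meet_iff:
  assumes "p \<noteq> 0" "q \<noteq> 0"
  shows "photon \<omega> p \<inter> photon \<omega> q \<noteq> {} \<longleftrightarrow> \<omega> p q = 0"
proof
  assume "photon \<omega> p \<inter> photon \<omega> q \<noteq> {}"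
  then show "\<omega> p q = 0"
    using span_base[of p "{p}"] span_base[of q "{q}"]
    by (force simp: photon_def Ein_def lagrangian_def)
next
  assume orth: "\<omega> p q = 0"
  have "\<exists>L \<in> Ein \<omega>. p \<in> L \<and> q \<in> L"
  \<comment> \<open>Independent \<open>p\<close> and \<open>q\<close> span the common Lagrangian
    plane themselves. For proportional vectors any Lagrangian plane through \<open>p\<close> will
    do, and an auxiliary \<open>r\<close> provides one.\<close>
  proof (cases "\<exists>k. q = k *\<^sub>R p")
    case True
    obtain r where r: "\<omega> p r = 0" "\<And>s t. s *\<^sub>R p + t *\<^sub>R r = 0 \<Longrightarrow> s = 0 \<and> t = 0"
      using ex_independent_orthogonal[OF assms(1)] by blast
    have "span {p, r} \<in> Ein \<omega>"
      using r by (intro span_pair_in_Ein)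
    moreover have "p \<in> span {p, r}" "q \<in> span {p, r}"
      using True by (auto simp: span_base intro: span_scale)
    ultimately show ?thesis
      by blast
  next
    case False
    have "s = 0 \<and> t = 0" if st: "s *\<^sub>R p + t *\<^sub>R q = 0" for s t
    proof -
      have "t = 0"
      proof (rule ccontr)
        assume "t \<noteq> 0"
        have "t *\<^sub>R q = (- s) *\<^sub>R p"
          using st by (simp add: eq_neg_iff_add_eq_0 add.commute)
        then have "q = (- s / t) *\<^sub>R p"
          using \<open>t \<noteq> 0\<close> by (metis divide_inverse_commute scaleR_scaleR left_inverse scaleR_one)
        then show False
          using False by blast
      qed
      with st assms(1) show ?thesis
        by simp
    qed
    then have "span {p, q} \<in> Ein \<omega>"
      using orth by (intro span_pair_in_Ein)
    then show ?thesis
      by (meson insertI1 insertI2 span_base)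
  qed
  then obtain L where L: "L \<in> Ein \<omega>" "p \<in> L" "q \<in> L"
    by blast
  then have "span {p} \<subseteq> L" "span {q} \<subseteq> L"
    by (simp_all add: Ein_def lagrangian_def span_minimal)
  with L show "photon \<omega> p \<inter> photon \<omega> q \<noteq> {}"
    by (auto simp: photon_def)
qed

section \<open>Photons and the wings\<close>

text \<open>By \<open>photons_meet_iff\<close>, meeting the wing means that the linear form
  \<open>t * \<omega> p up + s * \<omega> p vp\<close> has a nontrivial zero with
  \<open>t * s \<ge> 0\<close>.\<close>

lemma photon_disjoint_wing_plus:
  assumes "p \<noteq> 0"
  shows "photon \<omega> p \<inter> wing_plus \<omega> up vp = {} \<longleftrightarrow> \<omega> p vp * \<omega> p up > 0"
proof -
  have nz: "t *\<^sub>R up + s *\<^sub>R vp \<noteq> 0" if "(t, s) \<noteq> (0, 0)" for t s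
    using that by (auto simp: scaleR_frame comb_arith)
  have "photon \<omega> p \<inter> wing_plus \<omega> up vp = {} \<longleftrightarrow>
      (\<forall>t s. t * s \<ge> 0 \<and> (t, s) \<noteq> (0, 0) \<longrightarrow>
        photon \<omega> p \<inter> photon \<omega> (t *\<^sub>R up + s *\<^sub>R vp) = {})"
    unfolding wing_plus_def by blast
  also have "\<dots> \<longleftrightarrow> (\<forall>t s. t * s \<ge> 0 \<and> (t, s) \<noteq> (0, 0) \<longrightarrow> t * \<omega> p up + s * \<omega> p vp \<noteq> 0)"
    using photons_meet_iff[OF assms nz] by (simp add: bil_simps) blast
  finally show ?thesis
    by (simp only: positive_quadrant_no_root_iff)
qed

lemma photon_disjoint_wing_minus:
  assumes "p \<noteq> 0"
  shows "photon \<omega> p \<inter> wing_minus \<omega> um vm = {} \<longleftrightarrow> \<omega> p vm * \<omega> p um < 0"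
proof -
  have nz: "t *\<^sub>R um + s *\<^sub>R vm \<noteq> 0" if "(t, s) \<noteq> (0, 0)" for t s
    using that by (auto simp: scaleR_frame comb_arith)
  have "photon \<omega> p \<inter> wing_minus \<omega> um vm = {} \<longleftrightarrow>
      (\<forall>t s. t * s \<le> 0 \<and> (t, s) \<noteq> (0, 0) \<longrightarrow>
        photon \<omega> p \<inter> photon \<omega> (t *\<^sub>R um + s *\<^sub>R vm) = {})"
    unfolding wing_minus_def by blast
  also have "\<dots> \<longleftrightarrow> (\<forall>t s. t * s \<le> 0 \<and> (t, s) \<noteq> (0, 0) \<longrightarrow> t * \<omega> p um + s * \<omega> p vm \<noteq> 0)"
    using photons_meet_iff[OF assms nz] by (simp add: bil_simps) blast
  also have "\<dots> \<longleftrightarrow>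
      (\<forall>t s. t * s \<ge> 0 \<and> (t, s) \<noteq> (0, 0) \<longrightarrow> t * \<omega> p um + s * (- \<omega> p vm) \<noteq> 0)"
  proof -
    \<comment> \<open>The reflection of \<open>s\<close> swaps the two pairs of quadrants, reducing
      to the criterion used for the positive wing.\<close>
    have "(\<forall>t s. Q t s) \<longleftrightarrow> (\<forall>t s. Q t (- s))" for Q :: "real \<Rightarrow> real \<Rightarrow> bool"
      by (metis minus_minus)
    from this[of "\<lambda>t s. t * s \<le> 0 \<and> (t, s) \<noteq> (0, 0) \<longrightarrow> t * \<omega> p um + s * \<omega> p vm \<noteq> 0"]
    show ?thesis
      by simp
  qed
  finally show ?thesis
    by (simp only: positive_quadrant_no_root_iff) simp
qed

section \<open>Photons and the stem\<close>

lemma maslov_form_stem: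
  assumes "v = comb a b c d"
  shows "maslov_form \<omega> (span {vp, vm}) (span {up, um}) v = - (a * d + b * c)"
proof -
  have P0: "span {vp, vm} = {comb 0 0 s t | s t. True}"
    and Pinf: "span {up, um} = {comb s t 0 0 | s t. True}"
    by (auto simp: span_pair scaleR_frame comb_arith)
  have "proj_along (span {vp, vm}) (span {up, um}) v = comb 0 0 c d"
    by (rule proj_along_eqI[OF subspace_span subspace_span])
      (auto simp: P0 Pinf assms comb_arith simp flip: comb_0)
  moreover have "proj_along (span {up, um}) (span {vp, vm}) v = comb a b 0 0"
    by (rule proj_along_eqI[OF subspace_span subspace_span])
      (auto simp: P0 Pinf assms comb_arith simp flip: comb_0)
  ultimately show ?thesis
    by (simp add: maslov_form_def omega_comb)
qed

lemma photon_disjoint_stem: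
  assumes plus: "\<omega> p vp * \<omega> p up > 0" and minus: "\<omega> p vm * \<omega> p um < 0"
  shows "photon \<omega> p \<inter> stem \<omega> up um vp vm = {}"
proof (rule ccontr)
  assume "photon \<omega> p \<inter> stem \<omega> up um vp vm \<noteq> {}"
  then obtain w w' where w: "w \<in> span {up, vm}" "w' \<in> span {um, vp}" "w \<noteq> 0" "w' \<noteq> 0"
    and p_in: "p \<in> span {w, w'}"
    and index: "\<bar>maslov_index \<omega> (span {vp, vm}) (span {w, w'}) (span {up, um})\<bar> = 2"
    using span_base[of p "{p}"] by (auto simp: photon_def stem_def)
  obtain x y z r where w_comb: "w = comb x 0 0 y" and w'_comb: "w' = comb 0 z r 0"
    using w(1,2) by (auto simp: span_pair scaleR_frame comb_arith)
  obtain k l where "p = k *\<^sub>R w + l *\<^sub>R w'"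
    using p_in by (auto simp: span_pair)
  then have p: "p = comb (k * x) (l * z) (l * r) (k * y)"
    by (simp add: w_comb w'_comb comb_arith)
  have "(\<omega> p vp * \<omega> p up) * (\<omega> p vm * \<omega> p um) < 0"
    using plus minus by (rule mult_pos_neg)
  also have "(\<omega> p vp * \<omega> p up) * (\<omega> p vm * \<omega> p um) = (k * l)\<^sup>2 * (- (x * y) * - (z * r))"
    by (simp add: p omega_comb power2_eq_square)
  \<comment> \<open>The square \<open>(k * l)\<^sup>2\<close> is nonnegative, so the strict sign
    must come from the other factor, the product of the diagonal entries of the Maslov form.\<close>
  finally have sign: "- (x * y) * - (z * r) < 0"
    by (simp add: mult_less_0_iff not_less)
  have "s = 0 \<and> t = 0" if "s *\<^sub>R w + t *\<^sub>R w' = 0" for s t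
    using that w(3,4) by (auto simp: w_comb w'_comb comb_arith)
  note ind = independent_pairI[OF this]
  have "maslov_form \<omega> (span {vp, vm}) (span {up, um}) (s *\<^sub>R w + t *\<^sub>R w') =
      - (x * y) * s\<^sup>2 + - (z * r) * t\<^sup>2" for s t
    by (subst maslov_form_stem[of _ "s * x" "t * z" "t * r" "s * y"])
      (simp_all add: w_comb w'_comb comb_arith power2_eq_square)
  \<comment> \<open>The index is 0 here, whereas membership in the stem requires absolute value
    2.\<close>
  from signature_on_indefinite_plane[OF ind this sign] index show False
    by (simp add: maslov_index_def)
qed

end

theorem lemma9:
  fixes \<omega> :: "'v::real_vector \<Rightarrow> 'v \<Rightarrow> real"
    and up um vp vm p :: 'v
  assumes "dim (UNIV :: 'v set) = 4"
    and "symplectic_form \<omega>"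
    and "crooked_frame \<omega> up um vp vm"
    and "p \<noteq> 0"
  shows "photon \<omega> p \<inter> crooked_surface \<omega> up um vp vm = {} \<longleftrightarrow>
    \<omega> p vp * \<omega> p up > 0 \<and> \<omega> p vm * \<omega> p um < 0"
proof -
  interpret crooked_space \<omega> up um vp vm
    using assms(1-3) by unfold_locales
  show ?thesis
    using photon_disjoint_wing_plus[OF assms(4)] photon_disjoint_wing_minus[OF assms(4)]
      photon_disjoint_stem[of p]
    unfolding crooked_surface_def by (simp add: Int_Un_distrib) blast
qed

end
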